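(* Suppose that $\mathcal A$ is surjective and that the KKT set $\Omega_\star$ is nonempty. Let $\tau,\sigma>0$ satisfy $\tau\sigma\|\mathcal A\|^2<1$, let $\{(X_k,y_k)\}$ be generated by the PDHG iteration from some initial point $(X_0,y_0)\in\mathbb S^n\times\mathbb R^m$, set $S_k=C-\mathcal A^\ast y_k$, and suppose $(X_k,y_k,S_k)$ converges to a KKT point $(X_\star,y_\star,S_\star)\in\Omega_\star$ satisfying strict complementarity, $\operatorname{rank}X_\star+\operatorname{rank}S_\star=n$. Let $r=\operatorname{rank}X_\star$ and define $$Z_k=X_k-\tau(C-\mathcal A^\ast y_k)=X_k-\tau S_k,\qquad \widehat S_{k+1}=\tau^{-1}(X_{k+1}-Z_k).$$ Then $X_{k+1}=\Pi_{\mathbb S^n_+}(Z_k)$, and there exists an integer $k_{\mathrm{ID}}$ such that, for all $k\ge k_{\mathrm{ID}}$, $$\operatorname{inertia}(Z_k)=(r,n-r,0),\quad \operatorname{rank}(X_{k+1})=r,\quad \operatorname{rank}(\widehat S_{k+1})=n-r,\quad \widehat S_{k+1}\succeq0,\quad \langle X_{k+1},\widehat S_{k+1}\rangle=0.$$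
   Context: $\mathbb S^n$ is the space of real symmetric $n\times n$ matrices with inner product $\langle X,Y\rangle=\operatorname{tr}(XY)$ and Frobenius norm; $\mathbb S^n_+$ is the cone of positive semidefinite matrices and $\Pi_{\mathbb S^n_+}$ the Euclidean projection onto it. Data: $C,A_1,\dots,A_m\in\mathbb S^n$, $b\in\mathbb R^m$; $\mathcal A:\mathbb S^n\to\mathbb R^m$, $\mathcal AX=(\langle A_1,X\rangle,\dots,\langle A_m,X\rangle)$, with adjoint $\mathcal A^\ast y=\sum_i y_iA_i$; $\|\mathcal A\|$ is the operator norm induced by the Frobenius and Euclidean norms. The KKT set of the SDP pair (minimize $\langle C,X\rangle$ s.t. $\mathcal AX=b$, $X\in\mathbb S^n_+$; maximize $b^{\mathsf T}y$ s.t. $\mathcal A^\ast y+S=C$, $S\in\mathbb S^n_+$) is $$\Omega_\star=\{(X,y,S)\in\mathbb S^n\times\mathbb R^m\times\mathbb S^n\mid \mathcal AX=b,\ X\in\mathbb S^n_+,\ \mathcal A^\ast y+S=C,\ S\in\mathbb S^n_+,\ \langle X,S\rangle=0\};$$ its elements are called KKT points. PDHG iteration: $X_{k+1}=\Pi_{\mathbb S^n_+}\big(X_k-\tau(C-\mathcal A^\ast y_k)\big)$, $\ y_{k+1}=y_k+\sigma\big(b-\mathcal A(2X_{k+1}-X_k)\big)$. $\operatorname{inertia}(Z)$ is the triple (number of positive, number of negative, number of zero eigenvalues of $Z$), counted with multiplicity. *)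

theory Defs
  imports "HOL-Analysis.Analysis" "HOL-Computational_Algebra.Polynomial"
begin

definition sym_mats :: "(real^'n^'n) set" where
  "sym_mats = {X. transpose X = X}"

definition psd_cone :: "(real^'n^'n) set" where
  "psd_cone = {X \<in> sym_mats. \<forall>v. 0 \<le> v \<bullet> (X *v v)}"

definition mat_ip :: "real^'n^'n \<Rightarrow> real^'n^'n \<Rightarrow> real" where
  "mat_ip X Y = trace (X ** Y)"

text \<open>The library inner product and norm of real^'n^'n are the entrywise (Frobenius) ones.
  Hence norms, distances and limits of symmetric matrices below are those induced by mat_ip.\<close>

lemma mat_ip_eq_inner:
  fixes X Y :: "real^'n^'n"
  assumes "X \<in> sym_mats"
  shows "mat_ip X Y = X \<bullet> Y"
proof -
  have X: "X $ i $ j = X $ j $ i" for i j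
    using assms by (metis (mono_tags, lifting) mem_Collect_eq sym_mats_def transpose_def vec_lambda_beta)
  have "mat_ip X Y = (\<Sum>i\<in>UNIV. \<Sum>k\<in>UNIV. X $ i $ k * Y $ k $ i)"
    by (simp add: mat_ip_def trace_def matrix_matrix_mult_def)
  also have "\<dots> = (\<Sum>k\<in>UNIV. \<Sum>i\<in>UNIV. X $ i $ k * Y $ k $ i)"
    by (rule sum.swap)
  also have "\<dots> = X \<bullet> Y"
    by (simp add: inner_vec_def X)
  finally show ?thesis .
qed

lemma norm_eq_sqrt_mat_ip:
  fixes X :: "real^'n^'n"
  assumes "X \<in> sym_mats"
  shows "norm X = sqrt (mat_ip X X)"
  using assms by (simp add: mat_ip_eq_inner norm_eq_sqrt_inner)

definition proj_psd :: "real^'n^'n \<Rightarrow> real^'n^'n" where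
  "proj_psd Z = closest_point psd_cone Z"

lemma zero_in_psd_cone: "(0 :: real^'n^'n) \<in> psd_cone"
  by (simp add: psd_cone_def sym_mats_def transpose_def vec_eq_iff)

lemma subspace_sym_mats: "subspace (sym_mats :: (real^'n^'n) set)"
  by (auto simp: subspace_def sym_mats_def transpose_def vec_eq_iff)

lemma convex_psd_cone: "convex (psd_cone :: (real^'n^'n) set)"
proof (rule convexI)
  fix X Y :: "real^'n^'n" and u v :: real
  assume *: "X \<in> psd_cone" "Y \<in> psd_cone" "0 \<le> u" "0 \<le> v" "u + v = 1"
  have "u *\<^sub>R X + v *\<^sub>R Y \<in> sym_mats"
    using * by (auto simp: psd_cone_def intro!: subspace_add[OF subspace_sym_mats] subspace_scale[OF subspace_sym_mats])
  moreover have "0 \<le> w \<bullet> ((u *\<^sub>R X + v *\<^sub>R Y) *v w)" for w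
    using * by (simp add: psd_cone_def matrix_vector_mult_add_rdistrib inner_add_right
        scaleR_matrix_vector_assoc[symmetric])
  ultimately show "u *\<^sub>R X + v *\<^sub>R Y \<in> psd_cone"
    by (simp add: psd_cone_def)
qed

lemma closed_psd_cone: "closed (psd_cone :: (real^'n^'n) set)"
proof -
  have "closed {X :: real^'n^'n. 0 \<le> v \<bullet> (X *v v)}" for v
  proof (rule closed_Collect_le)
    show "continuous_on UNIV (\<lambda>X :: real^'n^'n. v \<bullet> (X *v v))"
      by (simp add: inner_vec_def matrix_vector_mult_def) (intro continuous_intros)
  qed simp
  then have "closed (\<Inter>v. {X :: real^'n^'n. 0 \<le> v \<bullet> (X *v v)})"
    by blast
  then have "closed (sym_mats \<inter> (\<Inter>v. {X :: real^'n^'n. 0 \<le> v \<bullet> (X *v v)}))"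
    by (rule closed_Int[OF closed_subspace[OF subspace_sym_mats]])
  moreover have "psd_cone = sym_mats \<inter> (\<Inter>v. {X :: real^'n^'n. 0 \<le> v \<bullet> (X *v v)})"
    by (auto simp: psd_cone_def)
  ultimately show ?thesis
    by metis
qed

definition sdp_map :: "('m::finite \<Rightarrow> real^'n^'n) \<Rightarrow> real^'n^'n \<Rightarrow> real^'m" where
  "sdp_map A X = (\<chi> i. mat_ip (A i) X)"

definition sdp_adj :: "('m::finite \<Rightarrow> real^'n^'n) \<Rightarrow> real^'m \<Rightarrow> real^'n^'n" where
  "sdp_adj A y = (\<Sum>i\<in>UNIV. (y $ i) *\<^sub>R A i)"

lemma sdp_adj_adjoint:
  fixes A :: "'m::finite \<Rightarrow> real^'n^'n"
  assumes "\<And>i. A i \<in> sym_mats"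
  shows "sdp_map A X \<bullet> y = sdp_adj A y \<bullet> X"
  using assms by (simp add: sdp_map_def sdp_adj_def inner_vec_def[of "_ :: real^'m"]
      inner_sum_left mat_ip_eq_inner mult.commute)

text \<open>As the library's onorm, but with the supremum over symmetric matrices only, since the
  domain of the operator is the space of symmetric matrices (with 0 / 0 = 0 for X = 0).\<close>

definition sdp_norm :: "('m::finite \<Rightarrow> real^'n^'n) \<Rightarrow> real" where
  "sdp_norm A = (SUP X\<in>sym_mats. norm (sdp_map A X) / norm X)"

lemma linear_sdp_map:
  assumes "\<And>i. A i \<in> sym_mats"
  shows "linear (sdp_map A :: real^'n^'n \<Rightarrow> real^('m::finite))"
  using assms by (intro linearI) (simp_all add: sdp_map_def mat_ip_eq_inner vec_eq_iff inner_add_right)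

text \<open>The supremum is finite, and is the operator norm.\<close>

lemma norm_sdp_map_le:
  fixes A :: "'m::finite \<Rightarrow> real^'n^'n"
  assumes "\<And>i. A i \<in> sym_mats" and X: "X \<in> sym_mats"
  shows "norm (sdp_map A X) \<le> sdp_norm A * norm X"
proof (cases "X = 0")
  case True
  then show ?thesis
    using linear_0[OF linear_sdp_map[OF assms(1)]] by simp
next
  case False
  have bl: "bounded_linear (sdp_map A)"
    using linear_sdp_map[OF assms(1)] by (simp add: linear_conv_bounded_linear)
  have "bdd_above ((\<lambda>X. norm (sdp_map A X) / norm X) ` sym_mats)"
    using le_onorm[OF bl] by (auto intro!: bdd_aboveI)
  then have "norm (sdp_map A X) / norm X \<le> sdp_norm A"
    unfolding sdp_norm_def using X by (rule cSUP_upper2) auto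
  then show ?thesis
    using False by (simp add: divide_le_eq)
qed

definition kkt_set :: "('m::finite \<Rightarrow> real^'n^'n) \<Rightarrow> real^'m \<Rightarrow> real^'n^'n
    \<Rightarrow> ((real^'n^'n) \<times> (real^'m) \<times> (real^'n^'n)) set" where
  "kkt_set A b C = {(X, y, S). X \<in> sym_mats \<and> S \<in> sym_mats \<and>
     sdp_map A X = b \<and> X \<in> psd_cone \<and>
     sdp_adj A y + S = C \<and> S \<in> psd_cone \<and> mat_ip X S = 0}"

definition charpoly :: "real^'n^'n \<Rightarrow> real poly" where
  "charpoly Z = det ((\<chi> i j. (if i = j then [:0, 1:] else 0) - [:Z $ i $ j:]) :: (real poly)^'n^'n)"

text \<open>Eigenvalues with multiplicity. For symmetric Z all roots of the characteristic polynomial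
  are real, and algebraic and geometric multiplicities agree.\<close>

definition eigvals :: "real^'n^'n \<Rightarrow> real multiset" where
  "eigvals Z = proots (charpoly Z)"

definition inertia :: "real^'n^'n \<Rightarrow> nat \<times> nat \<times> nat" where
  "inertia Z = (size {#a \<in># eigvals Z. 0 < a#}, size {#a \<in># eigvals Z. a < 0#}, count (eigvals Z) 0)"

definition pdhg :: "('m::finite \<Rightarrow> real^'n^'n) \<Rightarrow> real^'m \<Rightarrow> real^'n^'n \<Rightarrow> real \<Rightarrow> real
    \<Rightarrow> (nat \<Rightarrow> real^'n^'n) \<Rightarrow> (nat \<Rightarrow> real^'m) \<Rightarrow> bool" where
  "pdhg A b C \<tau> \<sigma> X y \<longleftrightarrow> X 0 \<in> sym_mats \<and>
     (\<forall>k. X (Suc k) = proj_psd (X k - \<tau> *\<^sub>R (C - sdp_adj A (y k))) \<and>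
          y (Suc k) = y k + \<sigma> *\<^sub>R (b - sdp_map A (2 *\<^sub>R X (Suc k) - X k)))"

end

theory Submission
  imports Defs
begin

text \<open>
  Projecting a symmetric matrix \<open>Z\<close> onto the positive semidefinite cone splits it as
  \<open>Z = P - N\<close> with \<open>P\<close> and \<open>N\<close> both positive semidefinite and orthogonal (Moreau's decomposition,
  using that the cone is self-dual).  For the iterates, \<open>P\<close> is \<open>X (Suc k)\<close> and \<open>N\<close> is
  \<open>\<tau> *\<^sub>R Shat (Suc k)\<close>, so semidefiniteness and complementarity of the pair hold at every step.

  Orthogonality of two semidefinite matrices forces \<open>N ** P = 0\<close>; their ranges are then orthogonal
  subspaces and the two ranks add up to at most \<open>n\<close>.  On the other hand
  \<open>X (Suc k)\<close> tends to \<open>Xs\<close> and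
  \<open>N = X (Suc k) - X k + \<tau> *\<^sub>R S k\<close> tends to \<open>\<tau> *\<^sub>R Ss\<close>.  Rank can only drop in a limit, so
  eventually the two ranks are at least \<open>rank Xs\<close> and \<open>rank Ss\<close>.  By strict complementarity these
  lower bounds already sum to \<open>n\<close>, and squeezing gives equality
  (\<open>psd_splitting_eventually_full_rank\<close>).

  Once the ranks of \<open>P\<close> and \<open>N\<close> sum to \<open>n\<close>, the inertia of \<open>Z\<close> can be read off: its quadratic form is
  positive on the range of \<open>P\<close> and negative on the range of \<open>N\<close>, and Sylvester's argument bounds
  the dimensions of these ranges by the numbers of positive and negative eigenvalues
  (\<open>inertia_psd_difference\<close>).  Counting eigenvalues as roots of the characteristic polynomial requires
  an orthogonal diagonalization of \<open>Z\<close>, that is, the spectral theorem for real symmetric matrices.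
\<close>

section \<open>The spectral theorem for real symmetric matrices\<close>

text \<open>
  A vector at which a semidefinite form vanishes minimizes the form, so the form cannot decrease to
  first order along \<open>w = g u\<close>; but its derivative there is \<open>2 * (w \<bullet> w)\<close>.  The statement is relative
  to an invariant subspace because the induction for the spectral theorem descends through such
  subspaces.
\<close>

lemma semidefinite_form_kernel:
  fixes g :: "'a::euclidean_space \<Rightarrow> 'a"
  assumes g: "linear g" and S: "subspace S" "g ` S \<subseteq> S"
    and self_adj: "\<And>x y. x \<in> S \<Longrightarrow> y \<in> S \<Longrightarrow> g x \<bullet> y = x \<bullet> g y"
    and nonneg: "\<And>x. x \<in> S \<Longrightarrow> 0 \<le> x \<bullet> g x"
    and u: "u \<in> S" "u \<bullet> g u = 0"
  shows "g u = 0"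
proof (rule ccontr)
  assume "g u \<noteq> 0"
  define w where "w = g u"
  define a where "a = w \<bullet> g w"
  define b where "b = w \<bullet> w"
  \<comment> \<open>A step against \<open>w\<close>, short enough that the quadratic term \<open>t\<^sup>2 * a\<close> cannot compensate
    the linear term \<open>2 * t * b\<close>; adding 1 covers the case \<open>a = 0\<close>.\<close>
  define t where "t = - b / (a + 1)"
  have wS: "w \<in> S" using S u by (auto simp: w_def)
  have a: "0 \<le> a" unfolding a_def by (rule nonneg[OF wS])
  have b: "0 < b" using \<open>g u \<noteq> 0\<close> by (simp add: b_def w_def)
  have "u + t *\<^sub>R w \<in> S" by (intro subspace_add subspace_scale S u wS)
  then have "0 \<le> (u + t *\<^sub>R w) \<bullet> g (u + t *\<^sub>R w)" by (rule nonneg)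
  also have "\<dots> = u \<bullet> g u + t * (u \<bullet> g w + w \<bullet> g u) + t\<^sup>2 * (w \<bullet> g w)"
    by (simp add: linear_add[OF g] linear_scale[OF g] inner_add_left inner_add_right
        algebra_simps power2_eq_square)
  also have "u \<bullet> g w = b" using self_adj[OF u(1) wS] by (simp add: b_def w_def)
  also have "w \<bullet> g u = b" by (simp add: b_def w_def)
  finally have "0 \<le> 2 * t * b + t\<^sup>2 * a" using u by (simp add: a_def)
  also have "b = - t * (a + 1)" using a by (simp add: t_def)
  also have "2 * t * (- t * (a + 1)) + t\<^sup>2 * a = - (t\<^sup>2 * (a + 2))"
    by (simp add: power2_eq_square algebra_simps)
  finally have "t\<^sup>2 * (a + 2) \<le> 0" by simp
  moreover have "0 < t\<^sup>2 * (a + 2)" using a b by (simp add: t_def)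
  ultimately show False by simp
qed

text \<open>
  The Rayleigh quotient attains its maximum \<open>c\<close> on the compact unit sphere of \<open>S\<close>, say at \<open>u\<close>.
  Then \<open>x \<mapsto> c *\<^sub>R x - f x\<close> has a semidefinite form that vanishes at \<open>u\<close>, so it maps \<open>u\<close> to \<open>0\<close>.
\<close>

lemma self_adjoint_eigenvector_exists:
  fixes f :: "'a::euclidean_space \<Rightarrow> 'a"
  assumes f: "linear f" and S: "subspace S" "f ` S \<subseteq> S"
    and self_adj: "\<And>x y. x \<in> S \<Longrightarrow> y \<in> S \<Longrightarrow> f x \<bullet> y = x \<bullet> f y"
    and nontriv: "\<not> S \<subseteq> {0}"
  obtains u c where "u \<in> S" "norm u = 1" "f u = c *\<^sub>R u"
proof -
  have unit: "x /\<^sub>R norm x \<in> S \<inter> sphere 0 1" if "x \<in> S" "x \<noteq> 0" for x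
    using that S by (simp add: subspace_scale)
  obtain x0 where "x0 \<in> S" "x0 \<noteq> 0" using nontriv by auto
  then have ne: "S \<inter> sphere 0 1 \<noteq> {}" using unit by blast
  have "compact (S \<inter> sphere 0 1)"
    by (intro closed_Int_compact closed_subspace S compact_sphere)
  moreover have "continuous_on (S \<inter> sphere 0 1) (\<lambda>x. x \<bullet> f x)"
    by (intro continuous_intros linear_continuous_on) (simp add: f linear_conv_bounded_linear[symmetric])
  ultimately obtain u where u: "u \<in> S \<inter> sphere 0 1"
    and max: "\<And>x. x \<in> S \<inter> sphere 0 1 \<Longrightarrow> x \<bullet> f x \<le> u \<bullet> f u"
    using continuous_attains_sup[OF _ ne] by blast
  define c where "c = u \<bullet> f u"
  define g where "g = (\<lambda>x. c *\<^sub>R x - f x)"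
  have uS: "u \<in> S" and nu: "norm u = 1" using u by auto
  have "g u = 0"
  proof (rule semidefinite_form_kernel[where g = g and S = S and u = u])
    show "linear g" unfolding g_def
      by (intro linearI) (simp_all add: linear_add[OF f] linear_scale[OF f] algebra_simps)
    show "subspace S" by fact
    show "g ` S \<subseteq> S" using S by (auto simp: g_def intro!: subspace_diff subspace_scale)
    show "g x \<bullet> y = x \<bullet> g y" if "x \<in> S" "y \<in> S" for x y
      using self_adj[OF that] by (simp add: g_def inner_diff_left inner_diff_right)
    show "0 \<le> x \<bullet> g x" if "x \<in> S" for x
    proof (cases "x = 0")
      case False
      have "(x /\<^sub>R norm x) \<bullet> f (x /\<^sub>R norm x) \<le> c"
        using max[OF unit[OF that False]] by (simp add: c_def)
      then have "x \<bullet> f x \<le> c * (norm x)\<^sup>2"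
        using False by (simp add: linear_scale[OF f] field_simps power2_eq_square)
      then show ?thesis by (simp add: g_def inner_diff_right power2_norm_eq_inner)
    qed simp
    show "u \<in> S" by fact
    show "u \<bullet> g u = 0"
      using nu by (simp add: g_def inner_diff_right c_def norm_eq_1)
  qed
  then show ?thesis using that[OF uS nu, of c] by (simp add: g_def)
qed

text \<open>
  The orthogonal complement, within \<open>S\<close>, of an eigenvector is again invariant under a self-adjoint
  map, so eigenvectors can be split off one at a time.
\<close>

lemma self_adjoint_orthonormal_eigenbasis:
  fixes f :: "'a::euclidean_space \<Rightarrow> 'a"
  assumes f: "linear f" and "subspace S" "f ` S \<subseteq> S"
    and "\<And>x y. x \<in> S \<Longrightarrow> y \<in> S \<Longrightarrow> f x \<bullet> y = x \<bullet> f y"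
  shows "\<exists>B. finite B \<and> card B = dim S \<and> pairwise orthogonal B \<and>
    (\<forall>u\<in>B. u \<in> S \<and> norm u = 1 \<and> (\<exists>c. f u = c *\<^sub>R u))"
  using assms(2-)
proof (induction "dim S" arbitrary: S)
  case 0
  then show ?case by (intro exI[of _ "{}"]) simp
next
  case (Suc n)
  note S = Suc.prems(1,2) and self_adj = Suc.prems(3)
  have "\<not> S \<subseteq> {0}" using Suc.hyps(2) by (metis dim_eq_0 nat.distinct(1))
  then obtain u c where u: "u \<in> S" "norm u = 1" "f u = c *\<^sub>R u"
    using self_adjoint_eigenvector_exists[OF f S self_adj] by metis
  define T where "T = {x \<in> S. u \<bullet> x = 0}"
  have subT: "subspace T"
    using S by (auto simp: T_def subspace_def inner_add_right)
  have "{y \<in> S. \<forall>x\<in>span {u}. orthogonal x y} = T"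
    by (auto simp: T_def orthogonal_def span_singleton)
  moreover have "dim (span {u}) = 1" using u(2) by (auto simp: dim_span dim_singleton)
  moreover have "span {u} \<subseteq> S" using S u by (simp add: span_minimal)
  ultimately have "dim T + 1 = dim S"
    using dim_subspace_orthogonal_to_vectors[OF subspace_span S(1), of "{u}"] by simp
  then have dimT: "n = dim T" using Suc.hyps(2) by simp
  have invT: "f ` T \<subseteq> T"
  proof clarify
    fix x assume x: "x \<in> T"
    then have "u \<bullet> f x = f u \<bullet> x" using self_adj[of u x] u by (simp add: T_def)
    then show "f x \<in> T" using x S u by (auto simp: T_def)
  qed
  obtain B where B: "finite B" "card B = dim T" "pairwise orthogonal B"
    "\<forall>v\<in>B. v \<in> T \<and> norm v = 1 \<and> (\<exists>c. f v = c *\<^sub>R v)"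
    using Suc.hyps(1)[OF dimT subT invT] self_adj by (auto simp: T_def)
  have "u \<notin> B" using B(4) u(2) by (auto simp: T_def)
  then show ?case
    using B u dimT Suc.hyps(2)
    by (intro exI[of _ "insert u B"])
      (auto simp: pairwise_insert T_def orthogonal_def inner_commute)
qed

definition diag_mat :: "('n \<Rightarrow> 'a::zero) \<Rightarrow> 'a^'n^'n" where
  "diag_mat d = (\<chi> i j. if i = j then d i else 0)"

lemma diag_mat_mult_vec: "(diag_mat d *v v) $ i = d i * v $ i"
  for d :: "'n::finite \<Rightarrow> 'a::semiring_1"
  by (simp add: diag_mat_def matrix_vector_mult_def if_distrib[of "\<lambda>x. x * _"] cong: if_cong)

lemma symmetric_matrix_inner:
  fixes M :: "real^'n^'n"
  assumes "M \<in> sym_mats"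
  shows "(M *v x) \<bullet> y = x \<bullet> (M *v y)"
  using assms by (metis (mono_tags) dot_lmul_matrix mem_Collect_eq sym_mats_def vector_transpose_matrix)

text \<open>
  The columns of \<open>Q\<close> are an orthonormal eigenbasis; \<open>M ** Q = Q ** diag_mat d\<close> is the list of
  eigenvalue equations, column by column.
\<close>

theorem symmetric_matrix_orthogonally_diagonalizable:
  fixes M :: "real^'n^'n"
  assumes "M \<in> sym_mats"
  obtains Q :: "real^'n^'n" and d where "orthogonal_matrix Q" "M = Q ** diag_mat d ** transpose Q"
proof -
  obtain B :: "(real^'n) set" where B: "finite B" "card B = CARD('n)" "pairwise orthogonal B"
    "\<forall>u\<in>B. norm u = 1 \<and> (\<exists>c. M *v u = c *\<^sub>R u)"
    using self_adjoint_orthonormal_eigenbasis[of "(*v) M" UNIV] symmetric_matrix_inner[OF assms]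
    by (auto simp: matrix_vector_mul_linear)
  obtain h :: "'n \<Rightarrow> real^'n" where h: "bij_betw h UNIV B"
    using finite_same_card_bij[of "UNIV :: 'n set" B] B(1,2) by auto
  have hB: "h j \<in> B" for j using h by (auto simp: bij_betw_def)
  have "\<forall>j. \<exists>c. M *v h j = c *\<^sub>R h j" using B(4) hB by blast
  then obtain d where d: "M *v h j = d j *\<^sub>R h j" for j by metis
  define Q :: "real^'n^'n" where "Q = (\<chi> i j. h j $ i)"
  have col: "column j Q = h j" for j by (simp add: Q_def column_def)
  have "orthogonal (h i) (h j)" if "i \<noteq> j" for i j
  proof (rule pairwiseD[OF B(3) hB hB])
    show "h i \<noteq> h j" using that bij_betw_imp_inj_on[OF h] by (simp add: inj_eq)
  qed
  then have Q: "orthogonal_matrix Q"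
    using B(4) hB by (simp add: orthogonal_matrix_orthonormal_columns col)
  have "(M ** Q) $ i $ j = (Q ** diag_mat d) $ i $ j" for i j
  proof -
    have "(M ** Q) $ i $ j = (M *v h j) $ i"
      by (simp add: matrix_matrix_mult_def matrix_vector_mult_def Q_def)
    also have "\<dots> = (Q ** diag_mat d) $ i $ j"
      by (simp add: d matrix_matrix_mult_def diag_mat_def Q_def if_distrib[of "\<lambda>x. _ * x"] cong: if_cong)
    finally show ?thesis .
  qed
  then have "M ** Q = Q ** diag_mat d" by (simp add: vec_eq_iff)
  then have "M ** (Q ** transpose Q) = Q ** diag_mat d ** transpose Q"
    by (simp add: matrix_mul_assoc)
  then show ?thesis using that[OF Q] Q by (simp add: orthogonal_matrix_def)
qed

section \<open>Inertia from definite subspaces\<close>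

lemma quadratic_form_diagonalized:
  fixes Q :: "real^'n^'n"
  shows "v \<bullet> ((Q ** diag_mat d ** transpose Q) *v v) = (\<Sum>i\<in>UNIV. d i * ((transpose Q *v v) $ i)\<^sup>2)"
proof -
  have "v \<bullet> ((Q ** diag_mat d ** transpose Q) *v v) = (transpose Q *v v) \<bullet> (diag_mat d *v (transpose Q *v v))"
    by (simp add: matrix_vector_mul_assoc[symmetric] dot_lmul_matrix[symmetric])
  also have "\<dots> = (\<Sum>i\<in>UNIV. d i * ((transpose Q *v v) $ i)\<^sup>2)"
    by (simp add: inner_vec_def diag_mat_mult_vec power2_eq_square algebra_simps)
  finally show ?thesis .
qed

text \<open>
  The inequality behind Sylvester's law of inertia.  The map taking \<open>v\<close> to the coordinates of
  \<open>transpose Q *v v\<close> at which \<open>d\<close> is positive is injective on \<open>V\<close>: where all of these coordinates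
  vanish, the quadratic form is nonpositive.
\<close>

lemma dim_positive_subspace_le:
  fixes Q :: "real^'n^'n" and V :: "(real^'n) set"
  assumes V: "subspace V"
    and pos: "\<And>v. v \<in> V \<Longrightarrow> v \<noteq> 0 \<Longrightarrow> 0 < v \<bullet> ((Q ** diag_mat d ** transpose Q) *v v)"
  shows "dim V \<le> card {i. 0 < d i}"
proof -
  define T :: "real^'n \<Rightarrow> real^'n" where
    "T v = (\<chi> i. if 0 < d i then (transpose Q *v v) $ i else 0)" for v
  have T: "linear T"
    by (intro linearI) (simp_all add: T_def vec_eq_iff matrix_vector_right_distrib matrix_vector_mult_scaleR)
  have "v = 0" if v: "v \<in> V" "T v = 0" for v
  proof (rule ccontr)
    assume "v \<noteq> 0"
    have "d i * ((transpose Q *v v) $ i)\<^sup>2 \<le> 0" for i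
    proof (cases "0 < d i")
      case True
      then have "(transpose Q *v v) $ i = 0" using v(2) by (auto simp: T_def vec_eq_iff split: if_splits)
      then show ?thesis by simp
    qed (simp add: mult_nonpos_nonneg)
    then have "v \<bullet> ((Q ** diag_mat d ** transpose Q) *v v) \<le> 0"
      unfolding quadratic_form_diagonalized by (rule sum_nonpos)
    then show False using pos[OF v(1) \<open>v \<noteq> 0\<close>] by simp
  qed
  then have "inj_on T V" using linear_injective_on_subspace_0[OF T V] by blast
  then have "dim V = dim (T ` V)"
    using dim_image_eq[OF T] V by (simp add: span_eq_iff[THEN iffD2])
  also have "\<dots> \<le> dim {x :: real^'n. \<forall>i. i \<notin> {i. 0 < d i} \<longrightarrow> x $ i = 0}"
    by (rule dim_subset) (auto simp: T_def)
  also have "\<dots> = card {i. 0 < d i}"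
    using dim_substandard_cart[of "{i. 0 < d i}", where 'a = real] by (simp add: dim_vec_eq)
  finally show ?thesis .
qed

lemma det_diag_mat: "det (diag_mat d) = (\<Prod>i\<in>UNIV. d i)" for d :: "'n::finite \<Rightarrow> 'a::comm_ring_1"
  by (subst det_diagonal) (simp_all add: diag_mat_def)

text \<open>
  Evaluating at each real \<open>t\<close> moves the determinant from polynomial matrices to real ones, where
  it can be computed from a diagonalization.
\<close>

lemma poly_charpoly: "poly (charpoly M) t = det (mat t - M)"
proof -
  have "poly (charpoly M) t =
    (\<Sum>p\<in>{p. p permutes UNIV}. of_int (sign p) * (\<Prod>i\<in>UNIV. (mat t - M) $ i $ p i))"
    unfolding charpoly_def det_def
    by (auto simp: poly_sum poly_prod mat_def sign_def intro!: sum.cong prod.cong arg_cong[where f=uminus])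
  then show ?thesis by (simp add: det_def)
qed

lemma orthogonal_conjugate_diag_affine:
  fixes Q :: "real^'n^'n"
  assumes "orthogonal_matrix Q"
  shows "Q ** diag_mat (\<lambda>i. t + c * d i) ** transpose Q
    = mat t + c *\<^sub>R (Q ** diag_mat d ** transpose Q)"
proof -
  have "diag_mat (\<lambda>i. t + c * d i) = t *\<^sub>R mat 1 + c *\<^sub>R diag_mat d"
    by (simp add: diag_mat_def mat_def vec_eq_iff)
  moreover have "mat t = t *\<^sub>R (mat 1 :: real^'n^'n)"
    by (simp add: mat_def vec_eq_iff)
  moreover have "(A + B) ** M = A ** M + B ** M" for A B M :: "real^'n^'n"
    by (vector matrix_matrix_mult_def sum.distrib[symmetric] distrib_right)
  ultimately show ?thesis
    using assms by (simp add: orthogonal_matrix_def matrix_add_ldistrib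
        matrix_scalar_ac scalar_matrix_assoc[symmetric])
qed

text \<open>
  The characteristic polynomial is unchanged by conjugation with \<open>Q\<close>, because
  \<open>det (Q ** transpose Q) = 1\<close>.
\<close>

lemma eigvals_diagonalized:
  fixes Q :: "real^'n^'n"
  assumes Q: "orthogonal_matrix Q" and M: "M = Q ** diag_mat d ** transpose Q"
  shows "eigvals M = image_mset d (mset_set UNIV)"
proof -
  have "poly (charpoly M) t = poly (\<Prod>i\<in>UNIV. [:- d i, 1:]) t" for t
  proof -
    have "mat t - M = Q ** diag_mat (\<lambda>i. t - d i) ** transpose Q"
      using orthogonal_conjugate_diag_affine[OF Q, of t "-1" d]
      by (simp add: M)
    then have "det (mat t - M) = det (Q ** transpose Q) * (\<Prod>i\<in>UNIV. t - d i)"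
      by (simp add: det_mul det_diag_mat)
    then show ?thesis using Q by (simp add: poly_charpoly orthogonal_matrix_def poly_prod)
  qed
  then have "charpoly M = (\<Prod>i\<in>UNIV. [:- d i, 1:])"
    by (simp add: poly_eq_poly_eq_iff[symmetric] fun_eq_iff)
  then have "eigvals M = (\<Sum>i\<in>UNIV. {#d i#})"
    by (simp add: eigvals_def proots_prod)
  then show ?thesis by (simp add: sum_unfold_sum_mset)
qed

section \<open>Orthogonal pairs of positive semidefinite matrices\<close>

lemma psd_cone_kernel:
  assumes "M \<in> psd_cone" "v \<bullet> (M *v v) = 0"
  shows "M *v v = 0"
  by (rule semidefinite_form_kernel[of "(*v) M" UNIV])
    (use assms in \<open>auto simp: psd_cone_def symmetric_matrix_inner\<close>)

lemma psd_positive_on_range: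
  assumes M: "M \<in> psd_cone" and v: "v \<in> range ((*v) M)" "v \<noteq> 0"
  shows "0 < v \<bullet> (M *v v)"
proof -
  have "M *v v \<noteq> 0"
  proof
    assume "M *v v = 0"
    obtain w where w: "v = M *v w" using v by auto
    have "v \<bullet> v = w \<bullet> (M *v v)"
      using M symmetric_matrix_inner[of M w v] by (simp add: w psd_cone_def)
    then show False using v \<open>M *v v = 0\<close> by simp
  qed
  moreover have "0 \<le> v \<bullet> (M *v v)" using M by (simp add: psd_cone_def)
  ultimately show ?thesis using psd_cone_kernel[OF M, of v] by fastforce
qed

text \<open>
  In an eigenbasis \<open>u i\<close> of \<open>P\<close> with eigenvalues \<open>d i\<close>, the inner product \<open>P \<bullet> N\<close> is the sum of the
  nonnegative terms \<open>d i * (u i \<bullet> (N *v u i))\<close>.  If it vanishes, then \<open>N\<close> kills every eigenvector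
  with \<open>d i \<noteq> 0\<close>, and these span the range of \<open>P\<close>.
\<close>

lemma psd_product_eq_0:
  fixes P N :: "real^'n^'n"
  assumes P: "P \<in> psd_cone" and N: "N \<in> psd_cone" and orth: "P \<bullet> N = 0"
  shows "N ** P = 0"
proof -
  obtain Q d where Q: "orthogonal_matrix Q" and PQ: "P = Q ** diag_mat d ** transpose Q"
    using symmetric_matrix_orthogonally_diagonalizable P unfolding psd_cone_def by blast
  have coords: "transpose Q *v column i Q = axis i 1" for i
    using Q by (metis matrix_vector_mul_assoc matrix_vector_mul_lid matrix_vector_mult_basis orthogonal_matrix)
  have "d i = column i Q \<bullet> (P *v column i Q)" for i
    unfolding PQ quadratic_form_diagonalized coords
    by (simp add: axis_def if_distrib[of "\<lambda>x. x\<^sup>2"] if_distrib[of "\<lambda>x. _ * x"] cong: if_cong)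
  then have d: "0 \<le> d i" for i using P by (simp add: psd_cone_def)
  have NQ: "0 \<le> column i Q \<bullet> (N *v column i Q)" for i using N by (simp add: psd_cone_def)
  have "P \<bullet> N = trace (P ** N)"
    using P mat_ip_eq_inner[of P N] by (simp add: mat_ip_def psd_cone_def)
  also have "\<dots> = trace (diag_mat d ** (transpose Q ** N ** Q))"
    unfolding PQ by (metis matrix_mul_assoc trace_mul_sym)
  also have "\<dots> = (\<Sum>i\<in>UNIV. d i * (column i Q \<bullet> (N *v column i Q)))"
  proof -
    have "(diag_mat d ** M) $ i $ i = d i * M $ i $ i" for M :: "real^'n^'n" and i
      by (simp add: diag_mat_def matrix_matrix_mult_def if_distrib[of "\<lambda>x. x * _"] cong: if_cong)
    moreover have "(transpose Q ** N ** Q) $ i $ i = column i Q \<bullet> (N *v column i Q)" for i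
      unfolding matrix_mul_assoc[symmetric]
      by (simp add: matrix_matrix_mult_def matrix_vector_mult_def
          inner_vec_def transpose_def column_def)
    ultimately show ?thesis by (simp add: trace_def)
  qed
  finally have "(\<Sum>i\<in>UNIV. d i * (column i Q \<bullet> (N *v column i Q))) = 0" using orth by simp
  then have "d i * (column i Q \<bullet> (N *v column i Q)) = 0" for i
    using d NQ by (subst (asm) sum_nonneg_eq_0_iff) auto
  then have "d i = 0 \<or> N *v column i Q = 0" for i using psd_cone_kernel[OF N] by auto
  then have "d i * (N *v column i Q) $ k = 0" for i k by (metis mult_eq_0_iff zero_index)
  moreover have "(N ** Q ** diag_mat d) $ k $ i = d i * (N *v column i Q) $ k" for i k
    by (simp add: diag_mat_def matrix_matrix_mult_def matrix_vector_mult_def column_def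
        if_distrib[of "\<lambda>x. _ * x"] cong: if_cong)
  ultimately have "N ** Q ** diag_mat d = 0" by (simp add: vec_eq_iff)
  then show ?thesis unfolding PQ by (metis matrix_mul_assoc times0_left)
qed

text \<open>
  For symmetric \<open>N\<close>, \<open>(P *v x) \<bullet> (N *v y) = ((N ** P) *v x) \<bullet> y\<close>, so the two ranges are orthogonal.
\<close>

lemma rank_add_le_of_product_eq_0:
  fixes P N :: "real^'n^'n"
  assumes N: "N \<in> sym_mats" and "N ** P = 0"
  shows "rank P + rank N \<le> CARD('n)"
proof -
  have "x \<bullet> y = 0" if "x \<in> range ((*v) P)" "y \<in> range ((*v) N)" for x y
    using that assms(2) symmetric_matrix_inner[OF N]
    by (metis (no_types, lifting) image_iff inner_zero_left matrix_vector_mul_assoc matrix_vector_mult_0)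
  then have "dim (range ((*v) P) \<union> range ((*v) N)) = rank P + rank N"
    unfolding rank_dim_range by (rule dim_orthogonal_sum)
  then show ?thesis by (metis dim_subset_UNIV_cart)
qed

text \<open>
  On the range of either matrix the other one vanishes, so \<open>P - N\<close> is positive on the range of \<open>P\<close> and
  negative on that of \<open>N\<close>.  The two lower bounds on eigenvalue counts sum to the total number of
  eigenvalues, which makes them exact and leaves no zero eigenvalue.
\<close>

lemma inertia_psd_difference:
  fixes P N :: "real^'n^'n"
  assumes P: "P \<in> psd_cone" and N: "N \<in> psd_cone" and NP: "N ** P = 0"
    and full: "rank P + rank N = CARD('n)"
  shows "inertia (P - N) = (rank P, rank N, 0)"
proof -
  have sym: "P \<in> sym_mats" "N \<in> sym_mats" using P N by (auto simp: psd_cone_def)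
  have PN: "P ** N = 0"
  proof -
    have "transpose (P ** N) = N ** P" using sym by (simp add: matrix_transpose_mul sym_mats_def)
    also have "\<dots> = transpose 0" by (simp add: NP transpose_def vec_eq_iff)
    finally show ?thesis by simp
  qed
  have "P - N \<in> sym_mats" using sym by (intro subspace_diff subspace_sym_mats)
  then obtain Q d where Q: "orthogonal_matrix Q" and Z: "P - N = Q ** diag_mat d ** transpose Q"
    by (rule symmetric_matrix_orthogonally_diagonalizable)
  have Z': "N - P = Q ** diag_mat (\<lambda>i. - d i) ** transpose Q"
    using orthogonal_conjugate_diag_affine[OF Q, of 0 "-1" d] by (simp add: Z[symmetric])
  have sub: "subspace (range ((*v) M))" for M :: "real^'n^'n"
    by (intro linear_subspace_image matrix_vector_mul_linear subspace_UNIV)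
  have pos: "rank P \<le> card {i. 0 < d i}"
    unfolding rank_dim_range
  proof (rule dim_positive_subspace_le[OF sub, of P Q d])
    fix v assume v: "v \<in> range ((*v) P)" "v \<noteq> 0"
    then have "N *v v = 0" using NP by (auto simp: matrix_vector_mul_assoc)
    then show "0 < v \<bullet> ((Q ** diag_mat d ** transpose Q) *v v)"
      using psd_positive_on_range[OF P v] by (simp add: Z[symmetric] matrix_vector_mult_diff_rdistrib)
  qed
  have neg: "rank N \<le> card {i. d i < 0}"
  proof -
    have "dim (range ((*v) N)) \<le> card {i. 0 < - d i}"
    proof (rule dim_positive_subspace_le[OF sub, of N Q "\<lambda>i. - d i"])
      fix v assume v: "v \<in> range ((*v) N)" "v \<noteq> 0"
      then have "P *v v = 0" using PN by (auto simp: matrix_vector_mul_assoc)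
      then show "0 < v \<bullet> ((Q ** diag_mat (\<lambda>i. - d i) ** transpose Q) *v v)"
        using psd_positive_on_range[OF N v] by (simp add: Z'[symmetric] matrix_vector_mult_diff_rdistrib)
    qed
    then show ?thesis by (simp add: rank_dim_range)
  qed
  have "CARD('n) = card ({i. 0 < d i} \<union> {i. d i < 0} \<union> {i. d i = 0})"
    by (rule arg_cong[where f = card]) auto
  also have "\<dots> = card {i. 0 < d i} + card {i. d i < 0} + card {i. d i = 0}"
    by (subst card_Un_disjoint, auto)+
  finally have "card {i. 0 < d i} = rank P" "card {i. d i < 0} = rank N" "card {i. d i = 0} = 0"
    using pos neg full by linarith+
  moreover have "size (filter_mset p (image_mset d (mset_set UNIV))) = card {i. p (d i)}" for p
    by (simp add: filter_mset_image_mset)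
  moreover have "count M 0 = size (filter_mset (\<lambda>a. a = 0) M)" for M :: "real multiset"
    by (simp add: filter_eq_replicate_mset eq_commute)
  ultimately show ?thesis
    by (simp add: inertia_def eigvals_diagonalized[OF Q Z] del: card_0_eq)
qed

section \<open>Moreau decomposition for the semidefinite cone\<close>

lemma proj_psd_in_psd_cone: "proj_psd Z \<in> psd_cone"
  unfolding proj_psd_def using closed_psd_cone zero_in_psd_cone by (intro closest_point_in_set) auto

text \<open>
  The variational inequality of the projection says that \<open>P\<close> minimizes \<open>(\<bullet>) N\<close> over the cone.
  Comparing with \<open>0\<close> and with twice \<open>P\<close> gives orthogonality and hence \<open>0 \<le> N \<bullet> Y\<close> on the cone;
  rank-one matrices \<open>Y\<close> turn this into semidefiniteness of \<open>N\<close>.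
\<close>

lemma proj_psd_Moreau:
  fixes Z :: "real^'n^'n"
  assumes "Z \<in> sym_mats"
  shows "proj_psd Z - Z \<in> psd_cone" "proj_psd Z \<bullet> (proj_psd Z - Z) = 0"
proof -
  define P where "P = proj_psd Z"
  define N where "N = P - Z"
  have P: "P \<in> psd_cone" by (simp add: P_def proj_psd_in_psd_cone)
  have var: "N \<bullet> P \<le> N \<bullet> Y" if "Y \<in> psd_cone" for Y
    using closest_point_dot[OF convex_psd_cone closed_psd_cone that, of Z]
    by (simp add: N_def P_def proj_psd_def algebra_simps)
  have "2 *\<^sub>R P \<in> psd_cone"
    using P by (auto simp: psd_cone_def scaleR_matrix_vector_assoc[symmetric] subspace_scale subspace_sym_mats)
  from var[OF this] var[OF zero_in_psd_cone] have NP: "N \<bullet> P = 0" by simp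
  then show "proj_psd Z \<bullet> (proj_psd Z - Z) = 0" by (simp add: N_def P_def inner_commute)
  have "0 \<le> v \<bullet> (N *v v)" for v
  proof -
    define Y :: "real^'n^'n" where "Y = (\<chi> i j. v $ i * v $ j)"
    have "w \<bullet> (Y *v w) = (v \<bullet> w)\<^sup>2" for w
      by (simp add: Y_def inner_vec_def matrix_vector_mult_def power2_eq_square sum_product
          sum_distrib_left algebra_simps)
    then have "Y \<in> psd_cone"
      by (simp add: psd_cone_def sym_mats_def) (simp add: Y_def transpose_def vec_eq_iff mult.commute)
    then have "0 \<le> N \<bullet> Y" using var NP by force
    also have "N \<bullet> Y = v \<bullet> (N *v v)"
      by (simp add: Y_def inner_vec_def matrix_vector_mult_def sum_distrib_left algebra_simps)
    finally show ?thesis .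
  qed
  moreover have "N \<in> sym_mats"
    using P assms by (auto simp: N_def psd_cone_def intro: subspace_diff subspace_sym_mats)
  ultimately show "proj_psd Z - Z \<in> psd_cone" by (simp add: psd_cone_def N_def P_def)
qed

section \<open>Lower semicontinuity of the rank\<close>

lemma norm_matrix_vector_mult_le:
  fixes M :: "real^'n^'m"
  shows "norm (M *v x) \<le> norm M * norm x"
proof -
  have "norm (M *v x) \<le> L2_set (\<lambda>i. norm (M $ i) * norm x) UNIV"
    unfolding norm_vec_def[of "M *v x"]
    by (intro L2_set_mono) (auto simp: matrix_vector_mul_component Cauchy_Schwarz_ineq2)
  also have "\<dots> = norm M * norm x"
    by (simp add: norm_vec_def[of M] L2_set_left_distrib)
  finally show ?thesis .
qed

text \<open>
  On its row space \<open>V\<close>, of dimension \<open>rank M\<close>, the matrix \<open>M\<close> is injective and hence bounded below by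
  some \<open>e > 0\<close>.  Matrices within distance \<open>e\<close> of \<open>M\<close> stay injective on \<open>V\<close>.
\<close>

lemma eventually_rank_ge:
  fixes f :: "'a \<Rightarrow> real^'n^'m"
  assumes "(f \<longlongrightarrow> M) F"
  shows "\<forall>\<^sub>F x in F. rank M \<le> rank (f x)"
proof -
  define V where "V = range ((*v) (transpose M))"
  have V: "subspace V" unfolding V_def
    by (intro linear_subspace_image matrix_vector_mul_linear subspace_UNIV)
  have dimV: "dim V = rank M"
    unfolding V_def by (metis rank_dim_range rank_transpose)
  have "\<forall>v\<in>V. M *v v = 0 \<longrightarrow> v = 0"
  proof (intro ballI impI)
    fix v assume "v \<in> V" "M *v v = 0"
    then obtain w where w: "v = transpose M *v w" by (auto simp: V_def)
    have "v \<bullet> v = w \<bullet> (M *v v)"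
      by (simp add: w dot_lmul_matrix[symmetric])
    then show "v = 0" using \<open>M *v v = 0\<close> by simp
  qed
  then obtain e where e: "0 < e" "\<And>v. v \<in> V \<Longrightarrow> e * norm v \<le> norm (M *v v)"
    using injective_imp_isometric[OF closed_subspace[OF V] V, of "(*v) M"]
    by (auto simp: matrix_vector_mul_bounded_linear)
  have "\<forall>\<^sub>F x in F. dist (f x) M < e" using assms e(1) by (rule tendstoD)
  then show ?thesis
  proof (rule eventually_mono)
    fix x assume near: "dist (f x) M < e"
    have "v = 0" if v: "v \<in> V" "f x *v v = 0" for v
    proof (rule ccontr)
      assume "v \<noteq> 0"
      have "e * norm v \<le> norm (M *v v)" by (rule e(2)[OF v(1)])
      also have "M *v v = (M - f x) *v v" using v(2) by (simp add: matrix_vector_mult_diff_rdistrib)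
      also have "norm \<dots> \<le> norm (M - f x) * norm v" by (rule norm_matrix_vector_mult_le)
      also have "\<dots> < e * norm v"
        using near \<open>v \<noteq> 0\<close> by (simp add: dist_norm norm_minus_commute)
      finally show False by simp
    qed
    then have "inj_on ((*v) (f x)) V"
      using linear_injective_on_subspace_0[OF matrix_vector_mul_linear V] by blast
    then have "dim V = dim ((*v) (f x) ` V)"
      using dim_image_eq[OF matrix_vector_mul_linear, of "f x" V] span_eq_iff[of V] V by metis
    also have "\<dots> \<le> rank (f x)"
      unfolding rank_dim_range by (intro dim_subset) auto
    finally show "rank M \<le> rank (f x)" by (simp add: dimV)
  qed
qed

lemma rank_scaleR:
  fixes M :: "real^'n^'m"
  assumes "c \<noteq> 0"
  shows "rank (c *\<^sub>R M) = rank M"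
proof -
  have "range ((*v) (c *\<^sub>R M)) = range ((*v) M)"
  proof (intro subset_antisym image_subsetI)
    show "(c *\<^sub>R M) *v x \<in> range ((*v) M)" for x
      by (rule range_eqI[of _ _ "c *\<^sub>R x"])
        (simp add: scaleR_matrix_vector_assoc[symmetric] matrix_vector_mult_scaleR)
    show "M *v x \<in> range ((*v) (c *\<^sub>R M))" for x
      by (rule range_eqI[of _ _ "inverse c *\<^sub>R x"])
        (simp add: assms scaleR_matrix_vector_assoc[symmetric] matrix_vector_mult_scaleR)
  qed
  then show ?thesis by (simp add: rank_dim_range)
qed

section \<open>Identification of the rank and the inertia\<close>

text \<open>
  The ranks are squeezed: semicontinuity bounds each from below by its limit value, while
  orthogonality bounds their sum by \<open>CARD('n)\<close>, the sum of the limit values.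
\<close>

lemma psd_splitting_eventually_full_rank:
  fixes P N :: "nat \<Rightarrow> real^'n^'n"
  assumes psd: "\<And>k. P k \<in> psd_cone" "\<And>k. N k \<in> psd_cone" and orth: "\<And>k. P k \<bullet> N k = 0"
    and lim: "P \<longlonglongrightarrow> P'" "N \<longlonglongrightarrow> N'"
    and full: "rank P' + rank N' = CARD('n)"
  shows "\<forall>\<^sub>F k in sequentially. rank (P k) = rank P' \<and> rank (N k) = rank N'"
  using eventually_rank_ge[OF lim(1)] eventually_rank_ge[OF lim(2)]
proof eventually_elim
  case (elim k)
  have "rank (P k) + rank (N k) \<le> CARD('n)"
    using psd psd_product_eq_0[OF psd orth]
    by (intro rank_add_le_of_product_eq_0) (auto simp: psd_cone_def)
  then show ?case using elim full by simp
qed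

theorem proposition1:
  fixes A :: "'m::finite \<Rightarrow> real^'n^'n"
    and C Xs Ss :: "real^'n^'n"
    and b ys :: "real^'m"
    and \<tau> \<sigma> :: real
    and r :: nat
    and X S Z Shat :: "nat \<Rightarrow> real^'n^'n"
    and y :: "nat \<Rightarrow> real^'m"
  assumes A_sym: "\<And>i. A i \<in> sym_mats"
    and C_sym: "C \<in> sym_mats"
    and A_surj: "sdp_map A ` sym_mats = UNIV"
    and KKT_nonempty: "kkt_set A b C \<noteq> {}"
    and \<tau>_pos: "0 < \<tau>" and \<sigma>_pos: "0 < \<sigma>"
    and step: "\<tau> * \<sigma> * (sdp_norm A)\<^sup>2 < 1"
    and iter: "pdhg A b C \<tau> \<sigma> X y"
    and S_eq: "\<And>k. S k = C - sdp_adj A (y k)"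
    and lim: "(\<lambda>k. (X k, y k, S k)) \<longlonglongrightarrow> (Xs, ys, Ss)"
    and KKT: "(Xs, ys, Ss) \<in> kkt_set A b C"
    and strict_compl: "rank Xs + rank Ss = CARD('n)"
    and r_eq: "r = rank Xs"
    and Z_eq: "\<And>k. Z k = X k - \<tau> *\<^sub>R (C - sdp_adj A (y k))"
    and Shat_eq: "\<And>k. Shat (Suc k) = inverse \<tau> *\<^sub>R (X (Suc k) - Z k)"
  shows "(\<forall>k. Z k = X k - \<tau> *\<^sub>R S k \<and> X (Suc k) = proj_psd (Z k)) \<and>
    (\<exists>k_ID. \<forall>k\<ge>k_ID.
       inertia (Z k) = (r, CARD('n) - r, 0) \<and>
       rank (X (Suc k)) = r \<and>
       rank (Shat (Suc k)) = CARD('n) - r \<and>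
       Shat (Suc k) \<in> psd_cone \<and>
       mat_ip (X (Suc k)) (Shat (Suc k)) = 0)"
proof -
  have X_Suc: "X (Suc k) = proj_psd (Z k)" for k using iter by (simp add: pdhg_def Z_eq)
  have Z_S: "Z k = X k - \<tau> *\<^sub>R S k" for k by (simp add: Z_eq S_eq)
  have X_psd: "X (Suc k) \<in> psd_cone" for k by (simp add: X_Suc proj_psd_in_psd_cone)
  have X_sym: "X k \<in> sym_mats" for k
    using iter X_psd by (cases k) (auto simp: pdhg_def psd_cone_def)
  have "sdp_adj A v \<in> sym_mats" for v
    unfolding sdp_adj_def by (intro subspace_sum subspace_scale subspace_sym_mats A_sym)
  then have Z_sym: "Z k \<in> sym_mats" for k
    unfolding Z_eq by (intro subspace_diff subspace_scale subspace_sym_mats X_sym C_sym)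
  define N where "N k = X (Suc k) - Z k" for k
  have N_psd: "N k \<in> psd_cone" and orth: "X (Suc k) \<bullet> N k = 0" for k
    using proj_psd_Moreau[OF Z_sym, of k] by (simp_all add: N_def X_Suc)
  have Z_split: "Z k = X (Suc k) - N k" for k by (simp add: N_def)
  have Shat_N: "Shat (Suc k) = inverse \<tau> *\<^sub>R N k" for k by (simp add: Shat_eq N_def)
  have limX: "X \<longlonglongrightarrow> Xs" and limS: "S \<longlonglongrightarrow> Ss"
    using tendsto_fst[OF lim] tendsto_snd[OF tendsto_snd[OF lim]] by simp_all
  have limX': "(\<lambda>k. X (Suc k)) \<longlonglongrightarrow> Xs" using limX by (rule LIMSEQ_Suc)
  \<comment> \<open>The increments \<open>X (Suc k) - X k\<close> vanish in the limit, which leaves the dual slack.\<close>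
  have "(\<lambda>k. X (Suc k) - X k + \<tau> *\<^sub>R S k) \<longlonglongrightarrow> Xs - Xs + \<tau> *\<^sub>R Ss"
    by (intro tendsto_intros limX limX' limS)
  then have limN: "N \<longlonglongrightarrow> \<tau> *\<^sub>R Ss" by (simp add: N_def[abs_def] Z_S algebra_simps)
  have rank_Ss: "rank Ss = CARD('n) - r" using strict_compl r_eq by simp
  have "\<forall>\<^sub>F k in sequentially. rank (X (Suc k)) = rank Xs \<and> rank (N k) = rank (\<tau> *\<^sub>R Ss)"
    by (rule psd_splitting_eventually_full_rank[OF X_psd N_psd orth limX' limN])
      (use \<tau>_pos strict_compl in \<open>simp add: rank_scaleR\<close>)
  then obtain K where K: "\<And>k. k \<ge> K \<Longrightarrow> rank (X (Suc k)) = r \<and> rank (N k) = CARD('n) - r"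
    using \<tau>_pos by (auto simp: eventually_sequentially rank_scaleR rank_Ss r_eq)
  show ?thesis
  proof (intro conjI allI exI[of _ K] impI)
    fix k assume k: "K \<le> k"
    have "rank (X (Suc k)) + rank (N k) = CARD('n)" using K[OF k] strict_compl r_eq by simp
    then show "inertia (Z k) = (r, CARD('n) - r, 0)"
      using inertia_psd_difference[OF X_psd N_psd psd_product_eq_0[OF X_psd N_psd orth]] K[OF k]
      by (simp add: Z_split)
    show "rank (X (Suc k)) = r" using K[OF k] by simp
    show "rank (Shat (Suc k)) = CARD('n) - r" using K[OF k] \<tau>_pos by (simp add: Shat_N rank_scaleR)
    show "Shat (Suc k) \<in> psd_cone"
      using N_psd[of k] \<tau>_pos
      by (auto simp: Shat_N psd_cone_def subspace_scale[OF subspace_sym_mats] scaleR_matrix_vector_assoc[symmetric])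
    show "mat_ip (X (Suc k)) (Shat (Suc k)) = 0"
      using orth X_sym by (simp add: Shat_N mat_ip_eq_inner)
  qed (simp_all add: Z_S X_Suc)
qed

end
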